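(* There exist a compact set $X \subset \mathbb{R}^2$, a Borel probability measure $\mu$ on $X$ with $\dim_H\mu = \mathrm{ID}(\mu) = 0$ and a Lipschitz map $T\colon X\rightarrow X$, such that for $k=1$ (so $\phi=h$) there is a non-empty open set $\mathcal U\subset\mathrm{Lip}(X)$ of Lipschitz observables with the following property: for every $h\in\mathcal U$, the prediction map $S \colon\phi(X_h)\rightarrow \phi(X)$ (provided it exists) is not continuous on a set of positive $\phi_*\mu$-measure, i.e. the set of points at which $S$ is discontinuous contains a Borel set of positive $\phi_*\mu$-measure. Therefore, the continuity of $S$ on a set of full $\phi_*\mu$-measure does not hold for a prevalent set of Lipschitz observables $h\colon X \to \mathbb{R}$.
   Context: $\mathrm{Lip}(X)$ is the Banach space of Lipschitz functions $h\colon X\to\mathbb{R}$ with norm $\sup_{x}|h(x)|+\sup_{x\ne y}|h(x)-h(y)|/\|x-y\|$. A Borel set $\mathcal S\subset V=\mathrm{Lip}(X)$ is prevalent if there is a Borel measure on $V$, positive and finite on some compact subset of $V$, such that for every $v\in V$ we have $v+e\in\mathcal S$ for almost every $e\in V$ with respect to this measure; a non-Borel subset is prevalent if it contains a prevalent Borel subset. With $\phi(x)=(h(x),\dots,h(T^{k-1}x))$, a prediction map exists if there is a Borel set $X_h\subset X$ of full $\mu$-measure such that for $x_1,x_2\in X_h$, $\phi(x_1)=\phi(x_2)$ implies $\phi(Tx_1)=\phi(Tx_2)$; then $S\colon\phi(X_h)\to\phi(X)$ is defined by $S(\phi(x))=\phi(Tx)$, $x\in X_h$. $\dim_H\mu$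 is the infimum of the Hausdorff dimensions of Borel sets of full $\mu$-measure. The lower/upper information dimension of $\mu$ is the $\liminf$/$\limsup$ as $\varepsilon\to0$ of $\int_{\operatorname{supp}\mu}\frac{\log\mu(B(x,\varepsilon))}{\log\varepsilon}d\mu(x)$; $\mathrm{ID}(\mu)$ is their common value if they agree. *)

theory Defs
  imports "HOL-Probability.Probability"
begin

section \<open>The space of Lipschitz observables\<close>

text \<open>
  Functions on \<open>X\<close> are represented by total functions that vanish outside \<open>X\<close>, so that equality
  of representatives is equality on \<open>X\<close> and the vector space operations are pointwise.
\<close>

definition Lip :: "'a::metric_space set \<Rightarrow> ('a \<Rightarrow> real) set" where
  "Lip X = {h. (\<exists>L. L-lipschitz_on X h) \<and> (\<forall>x. x \<notin> X \<longrightarrow> h x = 0)}"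

text \<open>
  In the second supremum the diagonal only contributes \<open>0 / 0 = 0\<close>, which makes the supremum \<open>0\<close>
  when \<open>X\<close> is a singleton. Both suprema are meaningful for \<open>X\<close> nonempty and bounded.
\<close>

definition lip_norm :: "'a::metric_space set \<Rightarrow> ('a \<Rightarrow> real) \<Rightarrow> real" where
  "lip_norm X h = (SUP x\<in>X. \<bar>h x\<bar>) + (SUP (x, y)\<in>X \<times> X. \<bar>h x - h y\<bar> / dist x y)"

text \<open>
  The value outside \<open>Lip X\<close> is irrelevant, but the locale \<open>Metric_space\<close> demands that a distance
  be nonnegative everywhere.
\<close>

definition lip_dist :: "'a::metric_space set \<Rightarrow> ('a \<Rightarrow> real) \<Rightarrow> ('a \<Rightarrow> real) \<Rightarrow> real" where
  "lip_dist X f g = (if f \<in> Lip X \<and> g \<in> Lip X then lip_norm X (\<lambda>x. f x - g x) else 0)"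

definition lip_topology :: "'a::metric_space set \<Rightarrow> ('a \<Rightarrow> real) topology" where
  "lip_topology X = Metric_space.mtopology (Lip X) (lip_dist X)"

definition lip_borel :: "'a::metric_space set \<Rightarrow> ('a \<Rightarrow> real) measure" where
  "lip_borel X = sigma (Lip X) {U. openin (lip_topology X) U}"

lemma Lip_diff:
  assumes "f \<in> Lip X" "g \<in> Lip X"
  shows "(\<lambda>x. f x - g x) \<in> Lip X"
  using assms unfolding Lip_def by (auto intro: lipschitz_on_diff)

lemma Lip_bdd_above:
  assumes X: "compact X" and h: "h \<in> Lip X"
  shows "bdd_above ((\<lambda>x. \<bar>h x\<bar>) ` X)"
    and "bdd_above ((\<lambda>(x, y). \<bar>h x - h y\<bar> / dist x y) ` (X \<times> X))"
proof -
  obtain L where L: "L-lipschitz_on X h"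
    using h by (auto simp: Lip_def)
  have "bounded (h ` X)"
    using X L by (intro compact_imp_bounded compact_continuous_image lipschitz_on_continuous_on)
  then show "bdd_above ((\<lambda>x. \<bar>h x\<bar>) ` X)"
    by (auto simp: bounded_iff bdd_above_def)
  have "\<bar>h x - h y\<bar> / dist x y \<le> L" if "x \<in> X" "y \<in> X" for x y
    using lipschitz_onD[OF L that] lipschitz_on_nonneg[OF L]
    by (cases "x = y") (auto simp: dist_real_def divide_le_eq)
  then show "bdd_above ((\<lambda>(x, y). \<bar>h x - h y\<bar> / dist x y) ` (X \<times> X))"
    by (auto simp: bdd_above_def intro!: exI[of _ L])
qed

lemma Metric_space_Lip:
  assumes X: "compact X" "X \<noteq> {}"
  shows "Metric_space (Lip X) (lip_dist X)"
proof -
  note bdd = Lip_bdd_above[OF X(1)]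
  have sup1: "\<bar>h x\<bar> \<le> (SUP x\<in>X. \<bar>h x\<bar>)" if "h \<in> Lip X" "x \<in> X" for h x
    using cSUP_upper[OF that(2) bdd(1)[OF that(1)]] .
  have sup2: "\<bar>h x - h y\<bar> / dist x y \<le> (SUP (x, y)\<in>X \<times> X. \<bar>h x - h y\<bar> / dist x y)"
    if "h \<in> Lip X" "x \<in> X" "y \<in> X" for h x y
    using cSUP_upper[OF _ bdd(2)[OF that(1)], of "(x, y)"] that by auto
  obtain a where a: "a \<in> X"
    using X by auto
  have nonneg: "0 \<le> lip_norm X h" and zero: "lip_norm X h = 0 \<Longrightarrow> x \<in> X \<Longrightarrow> h x = 0"
    if "h \<in> Lip X" for h x
  proof -
    have 1: "0 \<le> (SUP x\<in>X. \<bar>h x\<bar>)"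
      using sup1[OF that a] by linarith
    have 2: "0 \<le> (SUP (x, y)\<in>X \<times> X. \<bar>h x - h y\<bar> / dist x y)"
      using sup2[OF that a a] by simp
    show "0 \<le> lip_norm X h"
      using 1 2 by (simp add: lip_norm_def)
    show "h x = 0" if "lip_norm X h = 0" "x \<in> X"
      using 1 2 that sup1[OF \<open>h \<in> Lip X\<close> that(2)] by (simp add: lip_norm_def)
  qed
  show ?thesis
  proof
    show "0 \<le> lip_dist X f g" for f g
      using nonneg[OF Lip_diff, of f g] by (simp add: lip_dist_def)
    show "lip_dist X f g = lip_dist X g f" for f g
    proof -
      have "\<bar>f x - g x - (f y - g y)\<bar> = \<bar>g x - f x - (g y - f y)\<bar>" for x y
        by linarith
      then have "lip_norm X (\<lambda>x. f x - g x) = lip_norm X (\<lambda>x. g x - f x)"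
        by (simp only: lip_norm_def abs_minus_commute[of "f _" "g _"])
      then show ?thesis
        by (simp only: lip_dist_def conj_commute[of "f \<in> Lip X"])
    qed
    show "lip_dist X f g = 0 \<longleftrightarrow> f = g" if fg: "f \<in> Lip X" "g \<in> Lip X" for f g
    proof
      assume "lip_dist X f g = 0"
      then have "f x = g x" if "x \<in> X" for x
        using zero[OF Lip_diff[OF fg] _ that] fg by (simp add: lip_dist_def)
      moreover have "f x = g x" if "x \<notin> X" for x
        using fg that by (simp add: Lip_def)
      ultimately show "f = g"
        by blast
    next
      assume "f = g"
      then show "lip_dist X f g = 0"
        using X(2) by (simp add: lip_dist_def lip_norm_def case_prod_beta)
    qed
    show "lip_dist X f h \<le> lip_dist X f g + lip_dist X g h"
      if fgh: "f \<in> Lip X" "g \<in> Lip X" "h \<in> Lip X" for f g h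
    proof -
      define u where "u = (\<lambda>x. f x - g x)"
      define v where "v = (\<lambda>x. g x - h x)"
      have u: "u \<in> Lip X" and v: "v \<in> Lip X"
        using fgh by (auto simp: u_def v_def intro: Lip_diff)
      have "(\<lambda>x. f x - h x) = (\<lambda>x. u x + v x)"
        by (auto simp: u_def v_def)
      then have d: "lip_dist X f h = lip_norm X (\<lambda>x. u x + v x)"
          "lip_dist X f g = lip_norm X u" "lip_dist X g h = lip_norm X v"
        using fgh by (simp_all add: lip_dist_def u_def v_def)
      have "(SUP x\<in>X. \<bar>u x + v x\<bar>) \<le> (SUP x\<in>X. \<bar>u x\<bar>) + (SUP x\<in>X. \<bar>v x\<bar>)"
      proof (rule cSUP_least[OF X(2)])
        fix x assume x: "x \<in> X"
        show "\<bar>u x + v x\<bar> \<le> (SUP x\<in>X. \<bar>u x\<bar>) + (SUP x\<in>X. \<bar>v x\<bar>)"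
          using sup1[OF u x] sup1[OF v x] by linarith
      qed
      moreover have "(SUP (x, y)\<in>X \<times> X. \<bar>u x + v x - (u y + v y)\<bar> / dist x y) \<le>
          (SUP (x, y)\<in>X \<times> X. \<bar>u x - u y\<bar> / dist x y) + (SUP (x, y)\<in>X \<times> X. \<bar>v x - v y\<bar> / dist x y)"
      proof (rule cSUP_least; clarsimp simp: X(2))
        fix x y assume xy: "x \<in> X" "y \<in> X"
        have "\<bar>u x + v x - (u y + v y)\<bar> / dist x y \<le> (\<bar>u x - u y\<bar> + \<bar>v x - v y\<bar>) / dist x y"
          by (intro divide_right_mono) auto
        then show "\<bar>u x + v x - (u y + v y)\<bar> / dist x y \<le>
          (SUP (x, y)\<in>X \<times> X. \<bar>u x - u y\<bar> / dist x y) + (SUP (x, y)\<in>X \<times> X. \<bar>v x - v y\<bar> / dist x y)"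
          using sup2[OF u xy] sup2[OF v xy] by (simp add: add_divide_distrib)
      qed
      ultimately show ?thesis
        unfolding d lip_norm_def by linarith
    qed
  qed
qed


section \<open>Prevalence\<close>

definition prevalent_borel :: "'a::metric_space set \<Rightarrow> ('a \<Rightarrow> real) set \<Rightarrow> bool" where
  "prevalent_borel X S \<longleftrightarrow> S \<in> sets (lip_borel X) \<and>
    (\<exists>\<nu>. sets \<nu> = sets (lip_borel X) \<and>
      (\<exists>K. compactin (lip_topology X) K \<and> 0 < emeasure \<nu> K \<and> emeasure \<nu> K < \<infinity>) \<and>
      (\<forall>v\<in>Lip X. AE e in \<nu>. (\<lambda>x. v x + e x) \<in> S))"

definition prevalent :: "'a::metric_space set \<Rightarrow> ('a \<Rightarrow> real) set \<Rightarrow> bool" where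
  "prevalent X S \<longleftrightarrow> S \<subseteq> Lip X \<and> (\<exists>P\<subseteq>S. prevalent_borel X P)"


section \<open>Dimensions of measures\<close>

definition full_measure :: "'a measure \<Rightarrow> 'a set \<Rightarrow> bool" where
  "full_measure \<mu> A \<longleftrightarrow> A \<in> sets \<mu> \<and> emeasure \<mu> (space \<mu> - A) = 0"

text \<open>
  The covering sets are required to be bounded because \<open>diameter\<close> is only meaningful for bounded
  sets. Only exponents \<open>s > 0\<close> are used below, so the value of \<open>0 powr 0\<close> plays no role.
\<close>

definition hausdorff_premeasure :: "real \<Rightarrow> real \<Rightarrow> 'a::metric_space set \<Rightarrow> ennreal" where
  "hausdorff_premeasure s \<delta> A =
    (INF U\<in>{U :: nat \<Rightarrow> 'a set. A \<subseteq> (\<Union>i. U i) \<and> (\<forall>i. bounded (U i) \<and> diameter (U i) \<le> \<delta>)}.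
      \<Sum>i. ennreal (diameter (U i) powr s))"

definition hausdorff_measure :: "real \<Rightarrow> 'a::metric_space set \<Rightarrow> ennreal" where
  "hausdorff_measure s A = (SUP \<delta>\<in>{0<..}. hausdorff_premeasure s \<delta> A)"

definition hausdorff_dim :: "'a::metric_space set \<Rightarrow> ennreal" where
  "hausdorff_dim A = (INF s\<in>{s. 0 < s \<and> hausdorff_measure s A = 0}. ennreal s)"

definition hausdorff_dim_measure :: "'a::metric_space measure \<Rightarrow> ennreal" where
  "hausdorff_dim_measure \<mu> = (INF A\<in>{A. full_measure \<mu> A}. hausdorff_dim A)"

definition supp_measure :: "'a::metric_space measure \<Rightarrow> 'a set" where
  "supp_measure \<mu> = {x \<in> space \<mu>. \<forall>r>0. 0 < emeasure \<mu> (ball x r \<inter> space \<mu>)}"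

text \<open>
  For \<open>\<mu>\<close> a probability measure and \<open>\<epsilon> < 1\<close> the integrand is nonnegative on the support, so the
  nonnegative integral loses nothing.
\<close>

definition info_integral :: "'a::metric_space measure \<Rightarrow> real \<Rightarrow> ennreal" where
  "info_integral \<mu> \<epsilon> =
    (\<integral>\<^sup>+x\<in>supp_measure \<mu>. ennreal (ln (measure \<mu> (ball x \<epsilon> \<inter> space \<mu>)) / ln \<epsilon>) \<partial>\<mu>)"

definition lower_info_dim :: "'a::metric_space measure \<Rightarrow> ennreal" where
  "lower_info_dim \<mu> = Liminf (at_right 0) (info_integral \<mu>)"

definition upper_info_dim :: "'a::metric_space measure \<Rightarrow> ennreal" where
  "upper_info_dim \<mu> = Limsup (at_right 0) (info_integral \<mu>)"

definition has_info_dim :: "'a::metric_space measure \<Rightarrow> ennreal \<Rightarrow> bool" where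
  "has_info_dim \<mu> d \<longleftrightarrow> lower_info_dim \<mu> = d \<and> upper_info_dim \<mu> = d"


section \<open>Prediction maps\<close>

text \<open>
  Here \<open>\<phi>\<close> is the delay-coordinate map; for a single delay coordinate it is the observable itself.
  The predicate says that the set \<open>Xh\<close> witnesses the existence of a prediction map. As the set is
  not unique, it is a parameter of the prediction map.
\<close>

definition prediction_set ::
    "'a measure \<Rightarrow> ('a \<Rightarrow> 'a) \<Rightarrow> ('a \<Rightarrow> 'b) \<Rightarrow> 'a set \<Rightarrow> bool" where
  "prediction_set \<mu> T \<phi> Xh \<longleftrightarrow> full_measure \<mu> Xh \<and>
    (\<forall>x1\<in>Xh. \<forall>x2\<in>Xh. \<phi> x1 = \<phi> x2 \<longrightarrow> \<phi> (T x1) = \<phi> (T x2))"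

definition prediction_map :: "('a \<Rightarrow> 'a) \<Rightarrow> ('a \<Rightarrow> 'b) \<Rightarrow> 'a set \<Rightarrow> 'b \<Rightarrow> 'b" where
  "prediction_map T \<phi> Xh y = (THE z. \<exists>x\<in>Xh. \<phi> x = y \<and> z = \<phi> (T x))"

lemma prediction_map_eq:
  assumes "prediction_set \<mu> T \<phi> Xh" "x \<in> Xh"
  shows "prediction_map T \<phi> Xh (\<phi> x) = \<phi> (T x)"
  unfolding prediction_map_def
proof (rule the_equality)
  show "\<exists>x'\<in>Xh. \<phi> x' = \<phi> x \<and> \<phi> (T x) = \<phi> (T x')"
    using assms(2) by blast
  show "z = \<phi> (T x)" if "\<exists>x'\<in>Xh. \<phi> x' = \<phi> x \<and> z = \<phi> (T x')" for z
    using that assms by (metis prediction_set_def)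
qed

definition prediction_cont_points ::
    "('a \<Rightarrow> 'a) \<Rightarrow> ('a \<Rightarrow> 'b::t2_space) \<Rightarrow> 'a set \<Rightarrow> 'b set" where
  "prediction_cont_points T \<phi> Xh =
    {y \<in> \<phi> ` Xh. continuous (at y within \<phi> ` Xh) (prediction_map T \<phi> Xh)}"

definition prediction_discont_points ::
    "('a \<Rightarrow> 'a) \<Rightarrow> ('a \<Rightarrow> 'b::t2_space) \<Rightarrow> 'a set \<Rightarrow> 'b set" where
  "prediction_discont_points T \<phi> Xh =
    {y \<in> \<phi> ` Xh. \<not> continuous (at y within \<phi> ` Xh) (prediction_map T \<phi> Xh)}"

end

theory Submission
  imports Defs
begin

text \<open>
  The measure is purely atomic, so that both dimensions vanish, but its atoms are dense in a
  segment \<open>I\<close>; one further atom \<open>p\<close> lies off the segment. The map \<open>T\<close> collapses \<open>I\<close> to one endpoint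
  of \<open>I\<close> and sends \<open>p\<close> to the other one. If \<open>h\<close> is close to the first coordinate, then by the
  intermediate value theorem \<open>h p\<close> is attained by \<open>h\<close> on \<open>I\<close>, hence approximated by values of \<open>h\<close> at
  atoms of \<open>I\<close>. The prediction map sends these to a value near \<open>0\<close>, but sends \<open>h p\<close> to a value near
  \<open>1\<close>; and \<open>{h p}\<close> has positive measure.
\<close>

section \<open>Measures and prevalence\<close>

text \<open>For arbitrary \<open>g\<close> only this inequality survives: a simple function below
  \<open>g\<close> pulls back along \<open>f\<close> to a function below the composite. It spares a
  measurability proof for the integrand of \<open>info_integral\<close>.\<close>

lemma nn_integral_distr_le:
  assumes f: "f \<in> measurable M N"
  shows "(\<integral>\<^sup>+y. g y \<partial>distr M N f) \<le> (\<integral>\<^sup>+x. g (f x) \<partial>M)"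
  unfolding nn_integral_def[of "distr M N f"]
proof (rule SUP_least, clarify)
  fix s assume s: "simple_function (distr M N f) s" "s \<le> g"
  have "integral\<^sup>S (distr M N f) s = (\<integral>\<^sup>+y. s y \<partial>distr M N f)"
    using s(1) by (simp add: nn_integral_eq_simple_integral)
  also have "\<dots> = (\<integral>\<^sup>+x. s (f x) \<partial>M)"
    using f borel_measurable_simple_function[OF s(1)] by (intro nn_integral_distr) simp_all
  also have "\<dots> \<le> (\<integral>\<^sup>+x. g (f x) \<partial>M)"
    using s(2) by (intro nn_integral_mono) (simp add: le_fun_def)
  finally show "integral\<^sup>S (distr M N f) s \<le> (\<integral>\<^sup>+x. g (f x) \<partial>M)" .
qed

text \<open>Singletons cover \<open>A\<close> at every scale and each contributes
  \<open>0 powr s = 0\<close>. The exponent 0 itself is excluded, so the value 0 is reached only as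
  an infimum over \<open>s > 0\<close>.\<close>

lemma hausdorff_dim_countable:
  fixes A :: "'a::metric_space set"
  assumes "countable A"
  shows "hausdorff_dim A = 0"
proof -
  have pre: "hausdorff_premeasure s \<delta> A = 0" if "0 < s" "0 < \<delta>" for s \<delta>
  proof -
    define U :: "nat \<Rightarrow> 'a set" where "U n = (if A = {} then {} else {from_nat_into A n})" for n
    have "A \<subseteq> (\<Union>i. U i)"
      using range_from_nat_into[OF _ assms] by (auto simp: U_def)
    moreover have "bounded (U i) \<and> diameter (U i) = 0" for i
      by (simp add: U_def)
    ultimately have "hausdorff_premeasure s \<delta> A \<le> (\<Sum>i. ennreal (diameter (U i) powr s))"
      unfolding hausdorff_premeasure_def using that by (intro INF_lower) auto
    also have "\<dots> = 0"
      using \<open>\<And>i. bounded (U i) \<and> diameter (U i) = 0\<close> by simp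
    finally show ?thesis by simp
  qed
  have "hausdorff_measure s A = 0" if "0 < s" for s
    using pre[OF that] by (simp add: hausdorff_measure_def)
  then have le: "hausdorff_dim A \<le> ennreal s" if "0 < s" for s
    unfolding hausdorff_dim_def using that by (intro INF_lower) auto
  have "hausdorff_dim A \<le> 0"
  proof (rule ennreal_le_epsilon)
    fix e :: real assume "0 < e"
    then show "hausdorff_dim A \<le> 0 + ennreal e" using le by simp
  qed
  then show ?thesis by simp
qed

text \<open>Lets a small ball in \<open>Lip X\<close> control values at single points; the Lipschitz
  seminorm only adds a nonnegative term.\<close>

lemma abs_le_lip_norm:
  assumes X: "compact X" and h: "h \<in> Lip X" and x: "x \<in> X"
  shows "\<bar>h x\<bar> \<le> lip_norm X h"
proof -
  have "\<bar>h x\<bar> \<le> (SUP x\<in>X. \<bar>h x\<bar>)"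
    using cSUP_upper[OF x Lip_bdd_above(1)[OF X h]] .
  moreover have "0 \<le> (SUP (x, y)\<in>X \<times> X. \<bar>h x - h y\<bar> / dist x y)"
    using cSUP_upper[OF _ Lip_bdd_above(2)[OF X h], of "(x, x)"] x by simp
  ultimately show ?thesis
    by (simp add: lip_norm_def)
qed

text \<open>
  A compact set of positive measure is covered by finitely many balls as small as a given ball in
  the complement of \<open>S\<close>; one of them has positive measure, and it can be translated to that ball.
\<close>

lemma prevalent_meets_open:
  assumes X: "compact X" "X \<noteq> {}"
    and U: "openin (lip_topology X) U" "U \<noteq> {}"
    and S: "prevalent X S"
  shows "S \<inter> U \<noteq> {}"
proof
  assume disj: "S \<inter> U = {}"
  interpret L: Metric_space "Lip X" "lip_dist X"
    using X by (rule Metric_space_Lip)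
  have top: "lip_topology X = L.mtopology"
    by (simp add: lip_topology_def)
  obtain h0 where h0: "h0 \<in> U" using U by auto
  then obtain r where r: "0 < r" "L.mball h0 r \<subseteq> U" and h0L: "h0 \<in> Lip X"
    using U(1) unfolding top L.openin_mtopology by blast
  obtain P where P: "P \<subseteq> S" "prevalent_borel X P"
    using S by (auto simp: prevalent_def)
  then obtain \<nu> K where \<nu>: "sets \<nu> = sets (lip_borel X)"
    and K: "compactin L.mtopology K" "0 < emeasure \<nu> K"
    and ae: "\<And>v. v \<in> Lip X \<Longrightarrow> AE e in \<nu>. (\<lambda>x. v x + e x) \<in> P"
    unfolding prevalent_borel_def top by blast
  have KL: "K \<subseteq> Lip X"
    using compactin_subset_topspace[OF K(1)] by simp
  have open_sets: "V \<in> sets \<nu>" if "openin L.mtopology V" for V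
    using that openin_subset[OF that] openin_subset[of L.mtopology]
    unfolding \<nu> lip_borel_def top by (subst sets_measure_of) (auto simp: L.topspace_mtopology)
  have null: "emeasure \<nu> (L.mball c r) = 0" if c: "c \<in> Lip X" for c
  proof -
    have v: "(\<lambda>x. h0 x - c x) \<in> Lip X"
      using h0L c by (rule Lip_diff)
    have "(\<lambda>x. h0 x - c x + e x) \<notin> P" if e: "e \<in> L.mball c r" for e
    proof -
      have eL: "e \<in> Lip X" and d: "lip_dist X c e < r"
        using e by auto
      \<comment> \<open>The translate is the difference \<open>h0 - (c - e)\<close>, so closure
        under differences suffices.\<close>
      have 1: "(\<lambda>x. h0 x - c x + e x) \<in> Lip X"
        using Lip_diff[OF h0L Lip_diff[OF c eL]] by (simp add: algebra_simps)
      have "lip_dist X h0 (\<lambda>x. h0 x - c x + e x) = lip_dist X c e"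
        using 1 h0L c eL by (simp add: lip_dist_def)
      then have "(\<lambda>x. h0 x - c x + e x) \<in> L.mball h0 r"
        using 1 h0L d by simp
      then show ?thesis using r P disj by blast
    qed
    then have "AE e in \<nu>. e \<notin> L.mball c r"
      using ae[OF v] by (auto elim!: eventually_mono)
    then show ?thesis
      using AE_iff_null_sets[OF open_sets[OF L.openin_mball]] by blast
  qed
  have "\<exists>F. finite F \<and> F \<subseteq> (\<lambda>c. L.mball c r) ` K \<and> K \<subseteq> \<Union>F"
    using K(1) KL r(1) by (intro compactinD[OF K(1)]) force+
  then obtain F where F: "finite F" "F \<subseteq> (\<lambda>c. L.mball c r) ` K" "K \<subseteq> \<Union>F"
    by blast
  have "B \<in> null_sets \<nu>" if "B \<in> F" for B
    using that F(2) KL null open_sets[OF L.openin_mball] by (auto simp: null_sets_def)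
  then have "\<Union>F \<in> null_sets \<nu>"
    using F(1) null_sets_UN'[of F id \<nu>] by (simp add: countable_finite)
  then have "emeasure \<nu> K \<le> 0"
    using emeasure_mono[OF F(3), of \<nu>] by (auto simp: null_sets_def)
  then show False using K(2) by simp
qed

section \<open>Atomic measures with geometric weights\<close>

text \<open>The point \<open>f n\<close> receives weight \<open>(1/2) ^ Suc n\<close>, and
  repetitions in \<open>f\<close> add up. Pushing forward a pmf gives total mass 1, and geometric
  weights have finite entropy.\<close>

abbreviation geometric_atoms :: "'a::metric_space set \<Rightarrow> (nat \<Rightarrow> 'a) \<Rightarrow> 'a measure" where
  "geometric_atoms X f \<equiv> distr (measure_pmf (geometric_pmf (1/2))) (restrict_space borel X) f"

lemma measurable_geometric_atoms:
  assumes "range f \<subseteq> X"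
  shows "f \<in> measurable (measure_pmf (geometric_pmf (1/2))) (restrict_space borel X)"
  using assms by (auto simp: space_restrict_space)

lemma emeasure_geometric_atoms_ge:
  assumes f: "range f \<subseteq> X" and B: "B \<in> sets (restrict_space borel X)" "f n \<in> B"
  shows "ennreal ((1/2) ^ Suc n) \<le> emeasure (geometric_atoms X f) B"
proof -
  have "ennreal ((1/2) ^ Suc n) = emeasure (measure_pmf (geometric_pmf (1/2))) {n}"
    by (simp add: emeasure_pmf_single)
  also have "\<dots> \<le> emeasure (measure_pmf (geometric_pmf (1/2))) (f -` B)"
    using B by (intro emeasure_mono) auto
  also have "\<dots> = emeasure (geometric_atoms X f) B"
    using measurable_geometric_atoms[OF f] B by (simp add: emeasure_distr)
  finally show ?thesis .
qed

text \<open>Every atom has positive mass, so a null set contains none. Consequently each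
  \<open>Xh\<close> that carries a prediction map contains all atoms.\<close>

lemma full_measure_geometric_atoms:
  assumes f: "range f \<subseteq> X"
  shows "full_measure (geometric_atoms X f) A \<longleftrightarrow>
    A \<in> sets (restrict_space borel X) \<and> range f \<subseteq> A"
proof
  let ?\<mu> = "geometric_atoms X f"
  assume A: "full_measure ?\<mu> A"
  then have "space ?\<mu> - A \<in> sets (restrict_space borel X)"
    by (auto simp: full_measure_def)
  then have "f n \<notin> space ?\<mu> - A" for n
    using emeasure_geometric_atoms_ge[OF f, of "space ?\<mu> - A" n] A
    by (auto simp: full_measure_def)
  then show "A \<in> sets (restrict_space borel X) \<and> range f \<subseteq> A"
    using A f by (auto simp: full_measure_def space_restrict_space)
next
  assume A: "A \<in> sets (restrict_space borel X) \<and> range f \<subseteq> A"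
  then have "f -` (space (restrict_space borel X) - A) = {}"
    by auto
  with A show "full_measure (geometric_atoms X f) A"
    using emeasure_distr[OF measurable_geometric_atoms[OF f], of "space (restrict_space borel X) - A"]
    by (auto simp: full_measure_def)
qed

text \<open>The countable set of atoms already has full measure.\<close>

lemma hausdorff_dim_geometric_atoms:
  assumes f: "range f \<subseteq> X"
  shows "hausdorff_dim_measure (geometric_atoms X f) = 0"
proof -
  have "range f \<in> sets borel"
    by (rule sets.countable) (auto intro: borel_closed)
  then have "range f \<in> sets (restrict_space borel X)"
    using f by (auto simp: sets_restrict_space)
  then have "full_measure (geometric_atoms X f) (range f)"
    using full_measure_geometric_atoms[OF f] by simp
  then have "hausdorff_dim_measure (geometric_atoms X f) \<le> hausdorff_dim (range f)"
    unfolding hausdorff_dim_measure_def by (intro INF_lower) auto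
  then show ?thesis
    by (simp add: hausdorff_dim_countable)
qed

text \<open>
  A ball around an atom has at least the measure of the atom, so the integral is at most the
  (finite) entropy of the weights divided by \<open>- ln \<epsilon>\<close>.
\<close>

lemma info_dim_geometric_atoms:
  assumes f: "range f \<subseteq> X"
  shows "has_info_dim (geometric_atoms X f) 0"
proof -
  let ?\<mu> = "geometric_atoms X f"
  interpret prob_space ?\<mu>
    using measurable_geometric_atoms[OF f] by (intro measure_pmf.prob_space_distr)
  \<comment> \<open>The entropy of the weights \<open>(1/2) ^ Suc n\<close> is
    \<open>C * ln 2 / 2\<close>.\<close>
  define C where "C = (\<Sum>n. real (Suc n) * (1/2) ^ n)"
  have summ: "summable (\<lambda>n. real (Suc n) * (1/2) ^ n)"
    using geometric_deriv_sums[of "1/2::real"] by (auto simp: sums_iff)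
  have bound: "info_integral ?\<mu> \<epsilon> \<le> ennreal (C * ln 2 / 2 / - ln \<epsilon>)" if \<epsilon>: "0 < \<epsilon>" "\<epsilon> < 1" for \<epsilon>
  proof -
    have ln: "ln \<epsilon> < 0" using \<epsilon> by simp
    have le: "ln (measure ?\<mu> (ball (f n) \<epsilon> \<inter> space ?\<mu>)) / ln \<epsilon> \<le> real (Suc n) * (ln 2 / - ln \<epsilon>)" for n
    proof -
      let ?B = "ball (f n) \<epsilon> \<inter> space ?\<mu>"
      have B: "?B \<in> sets (restrict_space borel X)"
        by (auto simp: sets_restrict_space space_restrict_space Int_commute)
      have "ennreal ((1/2) ^ Suc n) \<le> ennreal (measure ?\<mu> ?B)"
        using emeasure_geometric_atoms_ge[OF f B, of n] f \<epsilon>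
        by (auto simp: space_restrict_space emeasure_eq_measure)
      then have "(1/2) ^ Suc n \<le> measure ?\<mu> ?B"
        by (subst (asm) ennreal_le_iff) auto
      then have "ln ((1/2) ^ Suc n) \<le> ln (measure ?\<mu> ?B)"
        by (intro ln_mono) auto
      moreover have "ln ((1/2) ^ Suc n) = - (real (Suc n) * ln 2)"
        by (subst ln_realpow) (simp_all add: ln_div del: of_nat_Suc)
      ultimately have "ln (measure ?\<mu> ?B) / ln \<epsilon> \<le> - (real (Suc n) * ln 2) / ln \<epsilon>"
        using ln by (intro divide_right_mono_neg) auto
      then show ?thesis by simp
    qed
    have "info_integral ?\<mu> \<epsilon> \<le> (\<integral>\<^sup>+n. ennreal (ln (measure ?\<mu> (ball (f n) \<epsilon> \<inter> space ?\<mu>)) / ln \<epsilon>) *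
        indicator (supp_measure ?\<mu>) (f n) \<partial>measure_pmf (geometric_pmf (1/2)))"
      unfolding info_integral_def
      by (rule nn_integral_distr_le[OF measurable_geometric_atoms[OF f]])
    also have "\<dots> \<le> (\<integral>\<^sup>+n. ennreal (real (Suc n) * (ln 2 / - ln \<epsilon>)) \<partial>measure_pmf (geometric_pmf (1/2)))"
      using le by (intro nn_integral_mono) (auto simp: indicator_def intro!: ennreal_leI)
    \<comment> \<open>The mass of \<open>n\<close> is \<open>(1/2) ^ n * (1/2)\<close>; the last
      factor moves into \<open>ln 2 / 2\<close>.\<close>
    also have "\<dots> = (\<integral>\<^sup>+n. ennreal (real (Suc n) * (1/2) ^ n * (ln 2 / 2 / - ln \<epsilon>)) \<partial>count_space UNIV)"
      using ln unfolding nn_integral_measure_pmf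
      by (intro nn_integral_cong) (simp add: field_simps flip: ennreal_mult')
    also have "\<dots> = ennreal (C * (ln 2 / 2 / - ln \<epsilon>))"
    proof -
      have "(\<lambda>n. real (Suc n) * (1/2) ^ n * (ln 2 / 2 / - ln \<epsilon>)) sums (C * (ln 2 / 2 / - ln \<epsilon>))"
        unfolding C_def using summ by (intro sums_mult2 summable_sums)
      then show ?thesis
        unfolding nn_integral_count_space_nat using ln
        by (intro suminf_ennreal_eq) (simp_all add: divide_nonneg_neg)
    qed
    finally show ?thesis by simp
  qed
  have "(info_integral ?\<mu> \<longlongrightarrow> 0) (at_right 0)"
  proof (rule tendsto_sandwich[OF _ _ tendsto_const])
    show "\<forall>\<^sub>F \<epsilon> in at_right 0. info_integral ?\<mu> \<epsilon> \<le> ennreal (C * ln 2 / 2 / - ln \<epsilon>)"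
      using bound by (intro eventually_at_rightI[of 0 1]) auto
    have "((\<lambda>\<epsilon>. C * ln 2 / 2 / - ln \<epsilon>) \<longlongrightarrow> 0) (at_right 0)"
      using ln_at_0 by (intro tendsto_divide_0[OF tendsto_const] filterlim_at_top_imp_at_infinity)
        (simp add: filterlim_uminus_at_bot)
    then show "((\<lambda>\<epsilon>. ennreal (C * ln 2 / 2 / - ln \<epsilon>)) \<longlongrightarrow> 0) (at_right 0)"
      using tendsto_ennrealI by fastforce
  qed simp
  then show ?thesis
    unfolding has_info_dim_def lower_info_dim_def upper_info_dim_def
    by (simp add: lim_imp_Liminf lim_imp_Limsup)
qed

section \<open>The example\<close>

theorem corollary8p2:
  shows "\<exists>(X :: (real^2) set) (\<mu> :: (real^2) measure) (T :: real^2 \<Rightarrow> real^2).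
    compact X \<and>
    prob_space \<mu> \<and> sets \<mu> = sets (restrict_space borel X) \<and>
    hausdorff_dim_measure \<mu> = 0 \<and> has_info_dim \<mu> 0 \<and>
    T \<in> X \<rightarrow> X \<and> (\<exists>L. L-lipschitz_on X T) \<and>
    (\<exists>U. openin (lip_topology X) U \<and> U \<noteq> {} \<and>
      (\<forall>h\<in>U. \<forall>Xh. prediction_set \<mu> T h Xh \<longrightarrow>
        (\<exists>D\<in>sets borel. D \<subseteq> prediction_discont_points T h Xh \<and>
          0 < emeasure (distr \<mu> borel h) D))) \<and>
    \<not> prevalent X {h \<in> Lip X. \<exists>Xh. prediction_set \<mu> T h Xh \<and>
        (\<exists>C. full_measure (distr \<mu> borel h) C \<and> C \<subseteq> prediction_cont_points T h Xh)}"
proof -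
  \<comment> \<open>The segment joins \<open>0\<close> to \<open>e\<close>, and \<open>p\<close>
    lies above its midpoint. Since \<open>T\<close> reads off the second coordinate, it is linear,
    kills \<open>I\<close> and sends \<open>p\<close> to \<open>e\<close>.\<close>
  define e :: "real^2" where "e = axis 1 1"
  define p :: "real^2" where "p = (1/2) *\<^sub>R e + axis 2 1"
  define I where "I = (\<lambda>t. t *\<^sub>R e) ` {0..1}"
  define X where "X = insert p I"
  define T :: "real^2 \<Rightarrow> real^2" where "T = (\<lambda>x. (x $ 2) *\<^sub>R e)"
  define h0 where "h0 = (\<lambda>x. if x \<in> X then x $ 1 else 0)"
  have coord: "e $ 1 = 1" "e $ 2 = 0" "p $ 1 = 1/2" "p $ 2 = 1"
    by (simp_all add: e_def p_def axis_def)
  have "compact I"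
    unfolding I_def by (intro compact_continuous_image continuous_intros) auto
  then have X: "compact X" "X \<noteq> {}"
    by (auto simp: X_def)
  have in_I: "0 \<in> I" "e \<in> I"
    by (auto simp: I_def image_iff intro: bexI[of _ 0] bexI[of _ 1])
  have in_X: "0 \<in> X" "e \<in> X" "p \<in> X" "I \<subseteq> X"
    using in_I by (auto simp: X_def)
  have T_I: "T x = 0" if "x \<in> I" for x
    using that by (auto simp: T_def I_def coord)
  have T_p: "T p = e"
    by (simp add: T_def coord)
  have T_X: "T \<in> X \<rightarrow> X"
    using T_I T_p in_X by (auto simp: X_def)
  have lip: "\<exists>L. L-lipschitz_on X g" if "bounded_linear g" for g :: "real^2 \<Rightarrow> 'b::real_normed_vector"
    using bounded_linear.lipschitz_boundE[OF that] by metis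
  have T_lip: "\<exists>L. L-lipschitz_on X T"
    unfolding T_def by (intro lip bounded_linear_scaleR_left[THEN bounded_linear_compose] bounded_linear_vec_nth)
  have "\<exists>L. L-lipschitz_on X h0"
    using lip[OF bounded_linear_vec_nth[of 1]] by (simp add: h0_def lipschitz_on_def)
  then have h0: "h0 \<in> Lip X"
    by (simp add: Lip_def h0_def)

  obtain Q where Q: "countable Q" "Q \<subseteq> I" "I \<subseteq> closure Q"
    using separable by blast
  have "Q \<noteq> {}" using Q in_I by auto
  \<comment> \<open>\<open>p\<close> comes first, so its mass is at least 1/2; the dense set
    \<open>Q\<close> shares the remaining weights.\<close>
  define f where "f = case_nat p (from_nat_into Q)"
  have f_range: "range f = insert p Q"
  proof -
    have "range f = insert (f 0) (f ` range Suc)"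
      by (metis UNIV_nat_eq image_insert)
    then show ?thesis
      using range_from_nat_into[OF \<open>Q \<noteq> {}\<close> Q(1)] by (simp add: f_def image_image)
  qed
  have f: "range f \<subseteq> X"
    using f_range Q by (auto simp: X_def)
  define \<mu> where "\<mu> = geometric_atoms X f"
  have prob: "prob_space \<mu>"
    unfolding \<mu>_def using measurable_geometric_atoms[OF f] by (intro measure_pmf.prob_space_distr)
  have sets: "sets \<mu> = sets (restrict_space borel X)"
    by (simp add: \<mu>_def)

  interpret L: Metric_space "Lip X" "lip_dist X"
    using X by (rule Metric_space_Lip)
  \<comment> \<open>At \<open>0\<close>, \<open>p\<close>, \<open>e\<close> the values of
    \<open>h0\<close> are 0, 1/2, 1. A perturbation below 1/4 keeps \<open>h p\<close> strictly
    between \<open>h 0\<close> and \<open>h e\<close>, and keeps the latter two more than 1/2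
    apart.\<close>
  define U where "U = L.mball h0 (1/4)"
  have U: "openin (lip_topology X) U" "U \<noteq> {}"
    using h0 L.centre_in_mball_iff[of h0 "1/4"]
    unfolding U_def lip_topology_def by (blast intro: L.openin_mball, force)
  have discont: "\<exists>D\<in>sets borel. D \<subseteq> prediction_discont_points T h Xh \<and>
      0 < emeasure (distr \<mu> borel h) D"
    if "h \<in> U" and Xh: "prediction_set \<mu> T h Xh" for h Xh
  proof -
    have hL: "h \<in> Lip X" and d: "lip_norm X (\<lambda>x. h0 x - h x) < 1/4"
      using \<open>h \<in> U\<close> h0 by (auto simp: U_def lip_dist_def)
    have close: "\<bar>h0 x - h x\<bar> < 1/4" if "x \<in> X" for x
      using abs_le_lip_norm[OF X(1) Lip_diff[OF h0 hL] that] d by simp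
    have vals: "h 0 < 1/4" "1/4 < h p" "h p < 3/4" "3/4 < h e"
      using close[OF in_X(1)] close[OF in_X(2)] close[OF in_X(3)] in_X
      unfolding abs_less_iff by (simp_all add: h0_def coord)
    have cont: "continuous_on X h"
      using hL lipschitz_on_continuous_on by (auto simp: Lip_def)
    have "continuous_on {0..1} (\<lambda>t. h (t *\<^sub>R e))"
      using in_X(4) by (intro continuous_on_compose2[OF cont] continuous_intros) (auto simp: I_def)
    then have "\<exists>t\<ge>0. t \<le> 1 \<and> h (t *\<^sub>R e) = h p"
      using vals by (intro IVT') auto
    \<comment> \<open>\<open>z\<close> may lie outside \<open>Xh\<close>; continuity at
      \<open>h p\<close> is therefore tested at points of \<open>Q\<close> near \<open>z\<close>,
      which do lie in \<open>Xh\<close>.\<close>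
    then obtain z where z: "z \<in> I" "h z = h p"
      unfolding I_def by (meson atLeastAtMost_iff image_eqI)
    have sub: "insert p Q \<subseteq> Xh"
      using Xh full_measure_geometric_atoms[OF f] f_range by (auto simp: prediction_set_def \<mu>_def)
    have "\<not> continuous (at (h p) within h ` Xh) (prediction_map T h Xh)"
    proof
      assume "continuous (at (h p) within h ` Xh) (prediction_map T h Xh)"
      then obtain \<delta> where \<delta>: "0 < \<delta>" "\<And>y. y \<in> h ` Xh \<Longrightarrow> dist y (h p) < \<delta> \<Longrightarrow>
          dist (prediction_map T h Xh y) (prediction_map T h Xh (h p)) < 1/2"
        unfolding continuous_within_eps_delta by (metis half_gt_zero_iff zero_less_one)
      obtain \<eta> where \<eta>: "0 < \<eta>" "\<And>x. x \<in> X \<Longrightarrow> dist x z < \<eta> \<Longrightarrow> dist (h x) (h z) < \<delta>"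
        using cont z(1) in_X(4) \<delta>(1) unfolding continuous_on_iff by (meson subsetD)
      obtain x where x: "x \<in> Q" "dist x z < \<eta>"
        using z(1) Q(3) \<eta>(1) closure_approachable by blast
      then have "x \<in> Xh" "x \<in> I"
        using sub Q(2) by auto
      have "dist (h x) (h p) < \<delta>"
        using \<eta>(2)[of x] x Q(2) in_X(4) z(2) by auto
      moreover have "prediction_map T h Xh (h x) = h 0"
        using prediction_map_eq[OF Xh \<open>x \<in> Xh\<close>] T_I[OF \<open>x \<in> I\<close>] by simp
      moreover have "prediction_map T h Xh (h p) = h e"
        using prediction_map_eq[OF Xh, of p] sub T_p by auto
      ultimately have "dist (h 0) (h e) < 1/2"
        using \<delta>(2)[of "h x"] \<open>x \<in> Xh\<close> by auto
      then show False
        using vals by (simp add: dist_real_def)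
    qed
    then have "{h p} \<subseteq> prediction_discont_points T h Xh"
      using sub by (auto simp: prediction_discont_points_def)
    moreover have "0 < emeasure (distr \<mu> borel h) {h p}"
    proof -
      have meas: "h \<in> borel_measurable (restrict_space borel X)"
        using cont by (rule borel_measurable_continuous_on_restrict)
      then have B: "h -` {h p} \<inter> X \<in> sets (restrict_space borel X)"
        using measurable_sets[OF meas, of "{h p}"] by (simp add: space_restrict_space)
      have "0 < ennreal ((1/2) ^ Suc 0)"
        by (subst ennreal_less_zero_iff) simp
      \<comment> \<open>The fibre of \<open>h\<close> over \<open>h p\<close> contains
        \<open>p = f 0\<close>, whence the exponent \<open>Suc 0\<close>.\<close>
      also have "\<dots> \<le> emeasure \<mu> (h -` {h p} \<inter> X)"
        unfolding \<mu>_def using in_X by (intro emeasure_geometric_atoms_ge[OF f B]) (simp add: f_def)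
      also have "\<dots> = emeasure (distr \<mu> borel h) {h p}"
        using meas by (subst emeasure_distr) (auto simp: \<mu>_def space_restrict_space)
      finally show ?thesis .
    qed
    ultimately show ?thesis
      by (intro bexI[of _ "{h p}"]) auto
  qed

  let ?S = "{h \<in> Lip X. \<exists>Xh. prediction_set \<mu> T h Xh \<and>
        (\<exists>C. full_measure (distr \<mu> borel h) C \<and> C \<subseteq> prediction_cont_points T h Xh)}"
  have "?S \<inter> U = {}"
  proof -
    have False if h: "h \<in> U" "prediction_set \<mu> T h Xh" and C: "full_measure (distr \<mu> borel h) C"
      "C \<subseteq> prediction_cont_points T h Xh" for h Xh C
    proof -
      obtain D where D: "D \<subseteq> prediction_discont_points T h Xh" "0 < emeasure (distr \<mu> borel h) D"
        using discont[OF h] by blast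
      \<comment> \<open>A full-measure set of continuity points would force \<open>D\<close> into
        its null complement.\<close>
      have "D \<subseteq> space (distr \<mu> borel h) - C"
        using C(2) D(1) by (auto simp: prediction_cont_points_def prediction_discont_points_def)
      then have "emeasure (distr \<mu> borel h) D \<le> emeasure (distr \<mu> borel h) (space (distr \<mu> borel h) - C)"
        using C(1) by (intro emeasure_mono) (auto simp: full_measure_def)
      then show False
        using C(1) D(2) by (simp add: full_measure_def)
    qed
    then show ?thesis by blast
  qed
  then have "\<not> prevalent X ?S"
    using prevalent_meets_open[OF X U] by blast
  then show ?thesis
    using X(1) prob sets hausdorff_dim_geometric_atoms[OF f] info_dim_geometric_atoms[OF f]
      T_X T_lip U discont
    unfolding \<mu>_def[symmetric]
    by (intro exI[of _ X] exI[of _ \<mu>] exI[of _ T] conjI exI[of _ U] ballI allI impI) simp_all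
qed

end
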